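(* (1) Let $\mathfrak{X}$ be a topological group and let $\mathfrak{M}$ be a normal subgroup of $\mathfrak{X}$ (with the subspace topology). Then the induced map $\pi_0(\mathfrak{M})\to\pi_0(\mathfrak{X})$ given by $\mathfrak{M}_1\gamma\mapsto\mathfrak{X}_1\gamma$, $\gamma\in\mathfrak{M}$, is a normal map. (2) Conversely, let $n\colon N\to G$ be a normal map of discrete groups. Then there exist a topological group $\mathfrak{X}$, a closed normal subgroup $\mathfrak{M}$ of $\mathfrak{X}$, and group isomorphisms $\alpha\colon\pi_0(\mathfrak{M})\to N$ and $\beta\colon\pi_0(\mathfrak{X})\to G$ such that, if $\bar n\colon\pi_0(\mathfrak{M})\to\pi_0(\mathfrak{X})$ denotes the map $\mathfrak{M}_1\gamma\mapsto\mathfrak{X}_1\gamma$ ($\gamma\in\mathfrak{M}$) induced by the inclusion, the square with horizontal maps $\bar n$ and $n$ and vertical maps $\alpha$ and $\beta$ commutes, i.e. first applying $\bar n$ and then $\beta$ equals first applying $\alpha$ and then $n$. (3) In addition, the topological groups $\mathfrak{M}$ and $\mathfrak{X}$ in part (2) realizing the map $n$ can be chosen to be homotopically discrete.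
   Context: For a topological group $\mathfrak{G}$, $\mathfrak{G}_1$ denotes the connected component of the identity of $\mathfrak{G}$, and $\pi_0(\mathfrak{G})=\mathfrak{G}/\mathfrak{G}_1$ is the group of connected components. A topological group is called homotopically discrete if its connected components are contractible. Maps are written on the right, and $x^y=y^{-1}xy$ denotes conjugation in a group. A group homomorphism $n\colon N\to G$ is called a normal map if it can be equipped with a crossed module structure, i.e. if there exists a homomorphism $\ell\colon G\to\mathrm{Aut}(N)$ (automorphisms acting on the right; write $a^g$ for the image of $a\in N$ under $\ell(g)$) such that (NM1) $(a^g)n=(an)^g$ for all $a\in N$, $g\in G$, where $(an)^g=g^{-1}(an)g$; and (NM2) $a^{bn}=a^b$ for all $a,b\in N$, where the left-hand side is the action of $bn\in G$ via $\ell$ and $a^b=b^{-1}ab$. *)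

theory Defs
  imports "HOL-Analysis.Analysis" "HOL-Algebra.Coset" "HOL-Algebra.Bij"
begin

section \<open>Topological groups and their groups of components\<close>

text \<open>No separation axiom is part of the definition.\<close>

locale topological_group = group G for G (structure) +
  fixes T :: "'a topology"
  assumes topspace_eq: "topspace T = carrier G"
    and continuous_mult: "continuous_map (prod_topology T T) T (\<lambda>(x, y). x \<otimes> y)"
    and continuous_inv: "continuous_map T T (\<lambda>x. inv x)"

definition identity_component :: "('a, 'b) monoid_scheme \<Rightarrow> 'a topology \<Rightarrow> 'a set" where
  "identity_component G T = connected_component_of_set T \<one>\<^bsub>G\<^esub>"

definition pi0 :: "('a, 'b) monoid_scheme \<Rightarrow> 'a topology \<Rightarrow> 'a set monoid" where
  "pi0 G T = G Mod identity_component G T"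

text \<open>A subgroup \<open>M\<close> of \<open>X\<close>, regarded as a topological group, is the pair
  \<open>X\<lparr>carrier := M\<rparr>\<close>, \<open>subtopology T M\<close>.\<close>

abbreviation pi0_sub :: "('a, 'b) monoid_scheme \<Rightarrow> 'a topology \<Rightarrow> 'a set \<Rightarrow> 'a set monoid" where
  "pi0_sub X T M \<equiv> pi0 (X\<lparr>carrier := M\<rparr>) (subtopology T M)"

text \<open>The map \<open>M\<^sub>1 \<gamma> \<mapsto> X\<^sub>1 \<gamma>\<close> sends a coset \<open>C\<close> to the common value of
  \<open>X\<^sub>1 \<gamma>\<close> for \<open>\<gamma> \<in> C\<close>; \<open>pi0_incl_coset\<close> below shows that there is exactly one.\<close>

definition pi0_incl :: "('a, 'b) monoid_scheme \<Rightarrow> 'a topology \<Rightarrow> 'a set \<Rightarrow> 'a set" where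
  "pi0_incl X T C = the_elem ((\<lambda>\<gamma>. identity_component X T #>\<^bsub>X\<^esub> \<gamma>) ` C)"

definition homotopically_discrete :: "'a topology \<Rightarrow> bool" where
  "homotopically_discrete T \<longleftrightarrow>
    (\<forall>C \<in> connected_components_of T. contractible_space (subtopology T C))"


section \<open>Normal maps\<close>

text \<open>The automorphism group acting on the right, i.e. with product ``first \<open>f\<close>, then \<open>g\<close>'';
  \<^const>\<open>AutoGroup\<close> has the opposite product \<open>f \<circ> g\<close>.\<close>

definition right_AutoGroup :: "('a, 'b) monoid_scheme \<Rightarrow> ('a \<Rightarrow> 'a) monoid" where
  "right_AutoGroup N = (AutoGroup N)\<lparr>mult := \<lambda>f g. g \<otimes>\<^bsub>AutoGroup N\<^esub> f\<rparr>"

definition conjugate :: "('a, 'b) monoid_scheme \<Rightarrow> 'a \<Rightarrow> 'a \<Rightarrow> 'a" where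
  "conjugate G x y = inv\<^bsub>G\<^esub> y \<otimes>\<^bsub>G\<^esub> x \<otimes>\<^bsub>G\<^esub> y"

definition crossed_module ::
  "('a, 'c) monoid_scheme \<Rightarrow> ('b, 'd) monoid_scheme \<Rightarrow> ('a \<Rightarrow> 'b) \<Rightarrow> ('b \<Rightarrow> 'a \<Rightarrow> 'a) \<Rightarrow> bool" where
  "crossed_module N G n l \<longleftrightarrow>
    group_hom N G n \<and>
    l \<in> hom G (right_AutoGroup N) \<and>
    (\<forall>a \<in> carrier N. \<forall>g \<in> carrier G. n (l g a) = conjugate G (n a) g) \<and>
    (\<forall>a \<in> carrier N. \<forall>b \<in> carrier N. l (n b) a = conjugate N a b)"

definition normal_map ::
  "('a, 'c) monoid_scheme \<Rightarrow> ('b, 'd) monoid_scheme \<Rightarrow> ('a \<Rightarrow> 'b) \<Rightarrow> bool" where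
  "normal_map N G n \<longleftrightarrow> (\<exists>l. crossed_module N G n l)"


section \<open>Well-definedness\<close>

lemma right_AutoGroup_mult:
  assumes "f \<in> carrier (right_AutoGroup N)" "g \<in> carrier (right_AutoGroup N)" "a \<in> carrier N"
  shows "(f \<otimes>\<^bsub>right_AutoGroup N\<^esub> g) a = g (f a)"
  using assms
  by (simp add: right_AutoGroup_def AutoGroup_def BijGroup_def auto_def compose_def)

context topological_group
begin

lemma identity_component_subset: "identity_component G T \<subseteq> carrier G"
  unfolding identity_component_def
  using connected_component_of_subset_topspace topspace_eq by metis

lemma one_in_identity_component: "\<one> \<in> identity_component G T"
  by (simp add: identity_component_def connected_component_of_refl topspace_eq)

lemma continuous_map_mult:
  assumes "continuous_map S T f" "continuous_map S T g"
  shows "continuous_map S T (\<lambda>x. f x \<otimes> g x)"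
proof -
  have "continuous_map S (prod_topology T T) (\<lambda>x. (f x, g x))"
    using assms by (simp add: continuous_map_pairedI)
  from continuous_map_compose[OF this continuous_mult] show ?thesis
    by (simp add: o_def)
qed

lemma continuous_image_in_identity_component:
  assumes f: "continuous_map T T f"
    and x: "x \<in> identity_component G T" "f x \<in> identity_component G T"
    and y: "y \<in> identity_component G T"
  shows "f y \<in> identity_component G T"
proof -
  have "connectedin T (identity_component G T)"
    by (simp add: identity_component_def connectedin_connected_component_of)
  then have "connectedin T (f ` identity_component G T)"
    using f connectedin_continuous_map_image by blast
  then have "connected_component_of T (f x) (f y)"
    using x y unfolding connected_component_of_def by blast
  then show ?thesis
    using x(2) unfolding identity_component_def
    by (auto intro: connected_component_of_trans)
qed

lemma subgroup_identity_component: "subgroup (identity_component G T) G"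
proof (rule subgroupI)
  show "identity_component G T \<subseteq> carrier G" by (rule identity_component_subset)
  show "identity_component G T \<noteq> {}" using one_in_identity_component by blast
next
  fix a assume "a \<in> identity_component G T"
  then show "inv a \<in> identity_component G T"
    using continuous_image_in_identity_component[OF continuous_inv, of \<one> a]
      one_in_identity_component by simp
next
  fix a b assume a: "a \<in> identity_component G T" and b: "b \<in> identity_component G T"
  have ac: "a \<in> carrier G" using a identity_component_subset by blast
  have "continuous_map T T (\<lambda>x. a \<otimes> x)"
    using ac by (intro continuous_map_mult) (auto simp: topspace_eq)
  from continuous_image_in_identity_component[OF this, of \<one> b]
  show "a \<otimes> b \<in> identity_component G T"
    using a b ac one_in_identity_component by simp
qed

lemma normal_identity_component: "identity_component G T \<lhd> G"
  unfolding normal_inv_iff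
proof (intro conjI ballI subgroup_identity_component)
  fix x h assume x: "x \<in> carrier G" and h: "h \<in> identity_component G T"
  have "continuous_map T T (\<lambda>y. x \<otimes> y \<otimes> inv x)"
    using x by (intro continuous_map_mult) (auto simp: topspace_eq)
  from continuous_image_in_identity_component[OF this, of \<one> h]
  show "x \<otimes> h \<otimes> inv x \<in> identity_component G T"
    using x h one_in_identity_component by simp
qed

lemma topological_group_subgroup:
  assumes "subgroup M G"
  shows "topological_group (G\<lparr>carrier := M\<rparr>) (subtopology T M)"
proof -
  interpret M: group "G\<lparr>carrier := M\<rparr>" using assms by (rule subgroup_imp_group)
  have MG: "M \<subseteq> carrier G" using assms by (rule subgroup.subset)
  show ?thesis
  proof
    show "topspace (subtopology T M) = carrier (G\<lparr>carrier := M\<rparr>)"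
      using MG by (auto simp: topspace_eq)
    have "continuous_map (prod_topology (subtopology T M) (subtopology T M)) T (\<lambda>(x, y). x \<otimes> y)"
      using continuous_map_from_subtopology[OF continuous_mult, of "M \<times> M"]
      by (simp add: subtopology_Times)
    then show "continuous_map (prod_topology (subtopology T M) (subtopology T M)) (subtopology T M)
        (\<lambda>(x, y). x \<otimes>\<^bsub>G\<lparr>carrier := M\<rparr>\<^esub> y)"
      using assms by (auto simp: continuous_map_in_subtopology subgroup.m_closed)
    have "continuous_map (subtopology T M) (subtopology T M) (\<lambda>x. inv x)"
      using continuous_map_from_subtopology[OF continuous_inv, of M] assms
      by (auto simp: continuous_map_in_subtopology subgroup.m_inv_closed)
    then show "continuous_map (subtopology T M) (subtopology T M) (\<lambda>x. inv\<^bsub>G\<lparr>carrier := M\<rparr>\<^esub> x)"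
      by (rule continuous_map_eq) (use assms m_inv_consistent in \<open>auto simp: topspace_eq\<close>)
  qed
qed

lemma group_pi0: "group (pi0 G T)"
  unfolding pi0_def by (rule normal.factorgroup_is_group[OF normal_identity_component])

lemma pi0_incl_coset:
  assumes M: "subgroup M G" and c: "\<gamma> \<in> M"
  shows "pi0_incl G T (identity_component (G\<lparr>carrier := M\<rparr>) (subtopology T M)
           #>\<^bsub>G\<lparr>carrier := M\<rparr>\<^esub> \<gamma>) = identity_component G T #> \<gamma>"
proof -
  let ?M1 = "identity_component (G\<lparr>carrier := M\<rparr>) (subtopology T M)"
  let ?X1 = "identity_component G T"
  interpret M: topological_group "G\<lparr>carrier := M\<rparr>" "subtopology T M"
    using M by (rule topological_group_subgroup)
  have c': "\<gamma> \<in> carrier G" using M c subgroup.subset by blast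
  have sub: "?M1 \<subseteq> ?X1"
  proof
    fix x assume "x \<in> ?M1"
    then have "connected_component_of (subtopology T M) \<one> x"
      by (simp add: identity_component_def)
    then have "connected_component_of (subtopology T UNIV) \<one> x"
      by (rule connected_component_of_mono) simp
    then show "x \<in> ?X1"
      by (simp add: identity_component_def)
  qed
  have eq: "?X1 #> (m \<otimes> \<gamma>) = ?X1 #> \<gamma>" if "m \<in> ?M1" for m
  proof -
    have m: "m \<in> ?X1" "m \<in> carrier G" using that sub identity_component_subset by auto
    then show ?thesis
      using c' by (metis coset_mult_assoc coset_join2 identity_component_subset
          subgroup_identity_component)
  qed
  have coset: "?M1 #>\<^bsub>G\<lparr>carrier := M\<rparr>\<^esub> \<gamma> = (\<lambda>m. m \<otimes> \<gamma>) ` ?M1"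
    by (auto simp: r_coset_def)
  have "?M1 \<noteq> {}" using M.one_in_identity_component by blast
  then have "(\<lambda>x. ?X1 #> x) ` (?M1 #>\<^bsub>G\<lparr>carrier := M\<rparr>\<^esub> \<gamma>) = {?X1 #> \<gamma>}"
    unfolding coset image_image using eq by (simp add: image_constant_conv cong: image_cong)
  then show ?thesis by (simp add: pi0_incl_def)
qed

end

end

theory Submission
  imports Defs
begin

text \<open>
  Write \<open>X1\<close> and \<open>M1\<close> for the identity components of \<open>X\<close> and of its normal subgroup \<open>M\<close>.
  The group \<open>X\<close> acts on \<open>M\<close> by conjugation, and this induces an action of \<open>\<pi>\<^sub>0(X)\<close> on \<open>\<pi>\<^sub>0(M)\<close>.
  The point is that \<open>X1\<close> acts trivially on components of \<open>M\<close>: for \<open>\<gamma> \<in> M\<close> the commutators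
  \<open>\<gamma>\<^sup>x \<gamma>\<^sup>-\<^sup>1\<close>, \<open>x \<in> X1\<close>, form a connected subset of \<open>M\<close> that contains the identity
  (\<open>commutator_X1_M\<close>). The crossed module axioms for \<open>\<pi>\<^sub>0(M) \<rightarrow> \<pi>\<^sub>0(X)\<close> are then inherited from
  the inclusion of \<open>M\<close> in \<open>X\<close> (\<open>crossed_module_pi0\<close>).

  Conversely, let \<open>n: N \<rightarrow> G\<close> be a normal map. The discrete group \<open>N\<close> embeds as the constants in
  the contractible group \<open>E\<close> of step functions from \<open>[0, 1)\<close> to \<open>N\<close>, metrized by the measure of
  the set on which two functions differ; the action of \<open>G\<close> on \<open>N\<close> extends to \<open>E\<close> pointwise.
  In the semidirect product of \<open>E\<close> with the discrete group \<open>G\<close> the elements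
  \<open>n(a) c(a)\<^sup>-\<^sup>1\<close>, where \<open>c(a)\<close> is the constant \<open>a\<close>, form a closed discrete subgroup \<open>K\<close>
  isomorphic to \<open>N\<close>. It is normal: \<open>E\<close> centralizes it, because \<open>n(a)\<close> and \<open>c(a)\<close> act on \<open>E\<close> in the
  same way by (NM2), and \<open>G\<close> permutes it as it does \<open>N\<close>, by (NM1). The components of the
  semidirect product are the contractible cosets of \<open>E\<close>, so its group of components is \<open>G\<close>; the
  components of \<open>K\<close> are points; and the projection to \<open>G\<close> restricts to \<open>n\<close> on \<open>K \<cong> N\<close>
  (\<open>crossed_module_realization\<close>). Both groups are homotopically discrete, so the same
  construction proves the second and the third part.
\<close>

section \<open>Components of a normal subgroup\<close>

lemma (in group) conjugate_closed:
  "x \<in> carrier G \<Longrightarrow> y \<in> carrier G \<Longrightarrow> conjugate G x y \<in> carrier G"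
  by (simp add: conjugate_def)

lemma (in group) conjugate_mult_left:
  "x \<in> carrier G \<Longrightarrow> y \<in> carrier G \<Longrightarrow> z \<in> carrier G \<Longrightarrow>
    conjugate G (x \<otimes> y) z = conjugate G x z \<otimes> conjugate G y z"
  by (simp add: conjugate_def m_assoc) (simp flip: m_assoc)

lemma (in group) conjugate_mult_right:
  "x \<in> carrier G \<Longrightarrow> y \<in> carrier G \<Longrightarrow> z \<in> carrier G \<Longrightarrow>
    conjugate G x (y \<otimes> z) = conjugate G (conjugate G x y) z"
  by (simp add: conjugate_def m_assoc inv_mult_group)

lemma (in group) conjugate_one [simp]: "x \<in> carrier G \<Longrightarrow> conjugate G x \<one> = x"
  by (simp add: conjugate_def)

lemma (in group_hom) hom_conjugate:
  "x \<in> carrier G \<Longrightarrow> y \<in> carrier G \<Longrightarrow> h (conjugate G x y) = conjugate H (h x) (h y)"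
  by (simp add: conjugate_def)

lemma (in normal) conjugate_mem: "h \<in> H \<Longrightarrow> x \<in> carrier G \<Longrightarrow> conjugate G h x \<in> H"
  by (simp add: conjugate_def inv_op_closed1)

lemma (in group) conjugate_subgroup:
  assumes "subgroup M G" "b \<in> M"
  shows "conjugate (G\<lparr>carrier := M\<rparr>) a b = conjugate G a b"
  using assms by (simp add: conjugate_def flip: m_inv_consistent)

context topological_group
begin

lemma group_hom_to_pi0: "group_hom G (pi0 G T) (\<lambda>x. identity_component G T #> x)"
proof (rule group_hom.intro)
  show "group_hom_axioms G (pi0 G T) (\<lambda>x. identity_component G T #> x)"
    unfolding pi0_def group_hom_axioms_def
    using normal.r_coset_hom_Mod[OF normal_identity_component] .
qed (use group_pi0 is_group in auto)

lemma carrier_pi0: "carrier (pi0 G T) = (\<lambda>x. identity_component G T #> x) ` carrier G"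
  by (simp add: pi0_def carrier_FactGroup)

end

locale topological_group_normal = topological_group +
  fixes M :: "'a set"
  assumes normal: "M \<lhd> G"
begin

abbreviation M1 where "M1 \<equiv> identity_component (G\<lparr>carrier := M\<rparr>) (subtopology T M)"
abbreviation X1 where "X1 \<equiv> identity_component G T"
abbreviation M_coset where "M_coset \<gamma> \<equiv> M1 #> \<gamma>"

sublocale nM: normal M G by (rule normal)
sublocale M: topological_group "G\<lparr>carrier := M\<rparr>" "subtopology T M"
  by (rule topological_group_subgroup) (rule nM.subgroup_axioms)

lemma M1_subset: "M1 \<subseteq> M"
  using M.identity_component_subset by simp

lemma M_coset_M: "M1 #>\<^bsub>G\<lparr>carrier := M\<rparr>\<^esub> \<gamma> = M_coset \<gamma>"
  by (simp add: r_coset_def)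

lemma carrier_pi0_sub: "carrier (pi0_sub G T M) = M_coset ` M"
  by (simp add: M.carrier_pi0 M_coset_M)

lemma group_hom_to_pi0_sub: "group_hom (G\<lparr>carrier := M\<rparr>) (pi0_sub G T M) M_coset"
  using M.group_hom_to_pi0 by (simp add: M_coset_M)

lemma M_coset_eq: "M_coset \<gamma> = (\<lambda>m. m \<otimes> \<gamma>) ` M1"
  by (auto simp: r_coset_def)

lemma continuous_conjugate_right:
  "a \<in> carrier G \<Longrightarrow> continuous_map T T (\<lambda>x. conjugate G a x)"
  unfolding conjugate_def by (intro continuous_map_mult continuous_inv) (auto simp: topspace_eq)

lemma continuous_conjugate_left:
  "a \<in> carrier G \<Longrightarrow> continuous_map T T (\<lambda>x. conjugate G x a)"
  unfolding conjugate_def by (intro continuous_map_mult continuous_inv) (auto simp: topspace_eq)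

text \<open>Conjugation by \<open>g\<close> maps \<open>M\<close> continuously to itself, because \<open>M\<close> is normal, and it fixes the
  identity; hence it preserves the component \<open>M1\<close>, and not only \<open>X1\<close>.\<close>

lemma conjugate_M1:
  assumes m: "m \<in> M1" and g: "g \<in> carrier G"
  shows "conjugate G m g \<in> M1"
proof -
  have "continuous_map (subtopology T M) (subtopology T M) (\<lambda>x. conjugate G x g)"
    using continuous_map_from_subtopology[OF continuous_conjugate_left[OF g], of M] g
    by (auto simp: continuous_map_in_subtopology nM.conjugate_mem)
  from M.continuous_image_in_identity_component[OF this, of \<one> m] show ?thesis
    using m g M.one_in_identity_component by (simp add: conjugate_def)
qed

text \<open>This is what makes the action of \<open>\<pi>\<^sub>0(X)\<close> well defined: \<open>x \<mapsto> \<gamma>\<^sup>x \<gamma>\<^sup>-\<^sup>1\<close> maps the connected set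
  \<open>X1\<close> continuously into \<open>M\<close> and sends the identity to the identity, so its image stays in
  the component \<open>M1\<close> of \<open>M\<close>.\<close>

lemma commutator_X1_M:
  assumes x: "x \<in> X1" and c: "\<gamma> \<in> M"
  shows "conjugate G \<gamma> x \<otimes> inv \<gamma> \<in> M1"
proof -
  let ?f = "\<lambda>x. conjugate G \<gamma> x \<otimes> inv \<gamma>"
  have c': "\<gamma> \<in> carrier G" using c by simp
  have "continuous_map T T ?f"
    using c' by (intro continuous_map_mult continuous_conjugate_right) (auto simp: topspace_eq)
  then have "continuous_map T (subtopology T M) ?f"
    using c by (auto simp: continuous_map_in_subtopology topspace_eq nM.conjugate_mem)
  moreover have "connectedin T X1"
    by (simp add: identity_component_def connectedin_connected_component_of)
  ultimately have "connectedin (subtopology T M) (?f ` X1)"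
    using connectedin_continuous_map_image by blast
  moreover have "?f \<one> = \<one>" using c' by simp
  ultimately show ?thesis
    using x one_in_identity_component
    by (force simp: identity_component_def[of "G\<lparr>carrier := M\<rparr>"] connected_component_of_def
        intro: exI[of _ "?f ` X1"])
qed

text \<open>The coset \<open>D\<close> is sent to the set of all conjugates \<open>d\<^sup>c\<close> with \<open>d \<in> D\<close> and \<open>c \<in> C\<close>, so that no
  representative has to be chosen. The restriction is there because the elements of
  \<^const>\<open>right_AutoGroup\<close> are extensional functions.\<close>

definition component_action :: "'a set \<Rightarrow> 'a set \<Rightarrow> 'a set" where
  "component_action C = (\<lambda>D \<in> carrier (pi0_sub G T M). \<Union>c\<in>C. (\<lambda>d. conjugate G d c) ` D)"

text \<open>A conjugate \<open>(m \<gamma>)\<close> by \<open>x g\<close> differs from \<open>\<gamma>\<^sup>g\<close> by the left factor \<open>(m\<^sup>x \<gamma>\<^sup>x \<gamma>\<^sup>-\<^sup>1)\<^sup>g\<close>, which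
  lies in \<open>M1\<close> by the two preceding lemmas; conversely every element of \<open>M1 \<gamma>\<^sup>g\<close> already arises
  with \<open>x = \<one>\<close>. So the action is computed on representatives, and all crossed module
  identities reduce to identities between conjugates in \<open>X\<close>.\<close>

lemma component_action_coset:
  assumes g: "g \<in> carrier G" and c: "\<gamma> \<in> M"
  shows "component_action (X1 #> g) (M_coset \<gamma>) = M_coset (conjugate G \<gamma> g)"
proof -
  have c': "\<gamma> \<in> carrier G" using c by simp
  have M1c: "m \<in> carrier G" if "m \<in> M1" for m using that M1_subset by auto
  have eq: "(\<Union>c\<in>X1 #> g. (\<lambda>d. conjugate G d c) ` M_coset \<gamma>) = M_coset (conjugate G \<gamma> g)" (is "?L = ?R")
  proof (intro equalityI subsetI)
    fix z assume "z \<in> ?L"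
    then obtain x m where x: "x \<in> X1" and m: "m \<in> M1" and z: "z = conjugate G (m \<otimes> \<gamma>) (x \<otimes> g)"
      by (auto simp: M_coset_eq r_coset_def)
    have x': "x \<in> carrier G" using x identity_component_subset by auto
    let ?k = "conjugate G \<gamma> x \<otimes> inv \<gamma>"
    let ?m = "conjugate G m x \<otimes> ?k"
    have k: "?k \<in> M1" using x c by (rule commutator_X1_M)
    have m': "?m \<in> M1"
      using M.subgroup_identity_component k conjugate_M1[OF m x'] subgroup.m_closed by fastforce
    have "conjugate G \<gamma> x = ?k \<otimes> \<gamma>" using x' c' by (simp add: m_assoc conjugate_closed)
    then have "conjugate G (m \<otimes> \<gamma>) x = ?m \<otimes> \<gamma>"
      using x' c' M1c[OF m] M1c[OF k] by (simp add: conjugate_mult_left conjugate_closed m_assoc)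
    then have z': "z = conjugate G ?m g \<otimes> conjugate G \<gamma> g"
      using z x' g c' M1c[OF m] M1c[OF m'] by (simp only: conjugate_mult_right conjugate_mult_left m_closed)
    then show "z \<in> ?R" using imageI[OF conjugate_M1[OF m' g], of "\<lambda>m. m \<otimes> conjugate G \<gamma> g"]
      by (simp only: M_coset_eq z')
  next
    fix z assume "z \<in> ?R"
    then obtain m where m: "m \<in> M1" and z: "z = m \<otimes> conjugate G \<gamma> g"
      by (auto simp: M_coset_eq)
    let ?m = "conjugate G m (inv g)"
    have m': "?m \<in> M1" using m g by (simp add: conjugate_M1)
    have "z = conjugate G (?m \<otimes> \<gamma>) g"
      using z g c' M1c[OF m] M1c[OF m'] by (simp add: conjugate_mult_left flip: conjugate_mult_right)
    moreover have "g \<in> X1 #> g"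
      using one_in_identity_component g by (force simp: r_coset_def)
    ultimately show "z \<in> ?L" using m' by (auto simp: M_coset_eq)
  qed
  have "M_coset \<gamma> \<in> carrier (pi0_sub G T M)" using c by (simp add: carrier_pi0_sub)
  then show ?thesis by (simp add: component_action_def eq)
qed

lemma component_action_auto:
  assumes C: "C \<in> carrier (pi0 G T)"
  shows "component_action C \<in> carrier (right_AutoGroup (pi0_sub G T M))"
proof -
  obtain g where g: "g \<in> carrier G" and C': "C = X1 #> g" using C by (auto simp: carrier_pi0)
  interpret q: group_hom "G\<lparr>carrier := M\<rparr>" "pi0_sub G T M" M_coset
    by (rule group_hom_to_pi0_sub)
  have hom: "component_action C \<in> hom (pi0_sub G T M) (pi0_sub G T M)"
  proof (rule homI)
    fix D assume "D \<in> carrier (pi0_sub G T M)"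
    then show "component_action C D \<in> carrier (pi0_sub G T M)"
      using g by (auto simp: C' carrier_pi0_sub component_action_coset nM.conjugate_mem)
  next
    fix D E assume "D \<in> carrier (pi0_sub G T M)" "E \<in> carrier (pi0_sub G T M)"
    then obtain a b where a: "a \<in> M" "D = M_coset a" and b: "b \<in> M" "E = M_coset b"
      by (auto simp: carrier_pi0_sub)
    have DE: "D \<otimes>\<^bsub>pi0_sub G T M\<^esub> E = M_coset (a \<otimes> b)"
      using a b q.hom_mult[of a b] by simp
    show "component_action C (D \<otimes>\<^bsub>pi0_sub G T M\<^esub> E) =
        component_action C D \<otimes>\<^bsub>pi0_sub G T M\<^esub> component_action C E"
      unfolding DE using a b g q.hom_mult[of "conjugate G a g" "conjugate G b g"]
      by (simp add: C' component_action_coset conjugate_mult_left nM.conjugate_mem)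
  qed
  have "bij_betw (component_action C) (carrier (pi0_sub G T M)) (carrier (pi0_sub G T M))"
    by (rule bij_betw_byWitness[where f' = "component_action (X1 #> inv g)"])
      (use g in \<open>auto simp: C' carrier_pi0_sub component_action_coset nM.conjugate_mem
          simp flip: conjugate_mult_right\<close>)
  then show ?thesis
    using hom by (simp add: right_AutoGroup_def AutoGroup_def auto_def Bij_def component_action_def)
qed

theorem crossed_module_pi0:
  "crossed_module (pi0_sub G T M) (pi0 G T) (pi0_incl G T) component_action"
proof -
  interpret q: group_hom "G\<lparr>carrier := M\<rparr>" "pi0_sub G T M" M_coset
    by (rule group_hom_to_pi0_sub)
  interpret p: group_hom G "pi0 G T" "\<lambda>x. X1 #> x" by (rule group_hom_to_pi0)
  have incl: "pi0_incl G T (M_coset a) = X1 #> a" if "a \<in> M" for a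
    using pi0_incl_coset[OF nM.subgroup_axioms that] by (simp add: M_coset_M)
  have "pi0_incl G T \<in> hom (pi0_sub G T M) (pi0 G T)"
  proof (rule homI)
    fix D E assume "D \<in> carrier (pi0_sub G T M)" "E \<in> carrier (pi0_sub G T M)"
    then obtain a b where a: "a \<in> M" "D = M_coset a" and b: "b \<in> M" "E = M_coset b"
      by (auto simp: carrier_pi0_sub)
    have DE: "D \<otimes>\<^bsub>pi0_sub G T M\<^esub> E = M_coset (a \<otimes> b)"
      using a b q.hom_mult[of a b] by simp
    show "pi0_incl G T (D \<otimes>\<^bsub>pi0_sub G T M\<^esub> E) = pi0_incl G T D \<otimes>\<^bsub>pi0 G T\<^esub> pi0_incl G T E"
      unfolding DE using a b by (simp add: incl)
  qed (auto simp: carrier_pi0_sub incl)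
  then have "group_hom (pi0_sub G T M) (pi0 G T) (pi0_incl G T)"
    using M.group_pi0 group_pi0 by (simp add: group_hom_def group_hom_axioms_def)
  moreover have "component_action \<in> hom (pi0 G T) (right_AutoGroup (pi0_sub G T M))"
  proof (rule homI)
    fix C D assume CD: "C \<in> carrier (pi0 G T)" "D \<in> carrier (pi0 G T)"
    then obtain g h where g: "g \<in> carrier G" "C = X1 #> g" and h: "h \<in> carrier G" "D = X1 #> h"
      by (auto simp: carrier_pi0)
    let ?R = "right_AutoGroup (pi0_sub G T M)"
    have CDeq: "C \<otimes>\<^bsub>pi0 G T\<^esub> D = X1 #> (g \<otimes> h)" using g h by simp
    have A: "component_action C \<in> carrier ?R" "component_action D \<in> carrier ?R"
      using CD by (auto intro: component_action_auto)
    show "component_action (C \<otimes>\<^bsub>pi0 G T\<^esub> D) = component_action C \<otimes>\<^bsub>?R\<^esub> component_action D"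
    proof (rule extensionalityI)
      show "component_action (C \<otimes>\<^bsub>pi0 G T\<^esub> D) \<in> extensional (carrier (pi0_sub G T M))"
        by (simp add: component_action_def)
      show "component_action C \<otimes>\<^bsub>?R\<^esub> component_action D \<in> extensional (carrier (pi0_sub G T M))"
        using A by (simp add: right_AutoGroup_def AutoGroup_def BijGroup_def auto_def compose_def)
      fix E assume E: "E \<in> carrier (pi0_sub G T M)"
      then obtain a where "a \<in> M" "E = M_coset a" by (auto simp: carrier_pi0_sub)
      then show "component_action (C \<otimes>\<^bsub>pi0 G T\<^esub> D) E = (component_action C \<otimes>\<^bsub>?R\<^esub> component_action D) E"
        unfolding right_AutoGroup_mult[OF A E] unfolding CDeq using g h
        by (simp add: component_action_coset nM.conjugate_mem conjugate_mult_right del: p.hom_mult)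
    qed
  qed (rule component_action_auto)
  moreover have "pi0_incl G T (component_action C D) = conjugate (pi0 G T) (pi0_incl G T D) C"
    if "D \<in> carrier (pi0_sub G T M)" "C \<in> carrier (pi0 G T)" for C D
  proof -
    obtain a where a: "a \<in> M" "D = M_coset a" using \<open>D \<in> _\<close> by (auto simp: carrier_pi0_sub)
    obtain g where g: "g \<in> carrier G" "C = X1 #> g" using \<open>C \<in> _\<close> by (auto simp: carrier_pi0)
    from a g show ?thesis
      by (simp add: component_action_coset incl nM.conjugate_mem p.hom_conjugate)
  qed
  moreover have "component_action (pi0_incl G T E) D = conjugate (pi0_sub G T M) D E"
    if "D \<in> carrier (pi0_sub G T M)" "E \<in> carrier (pi0_sub G T M)" for D E
  proof -
    obtain a where a: "a \<in> M" "D = M_coset a" using \<open>D \<in> _\<close> by (auto simp: carrier_pi0_sub)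
    obtain b where b: "b \<in> M" "E = M_coset b" using \<open>E \<in> _\<close> by (auto simp: carrier_pi0_sub)
    note ab = a b
    have "conjugate (pi0_sub G T M) D E = M_coset (conjugate G a b)"
      using ab q.hom_conjugate[of a b] conjugate_subgroup[OF nM.subgroup_axioms, of b a] by simp
    then show ?thesis using ab by (simp add: component_action_coset incl)
  qed
  ultimately show ?thesis unfolding crossed_module_def by blast
qed

end


section \<open>Semidirect products with a discrete group\<close>

text \<open>Over a discrete factor, continuity and closedness can be tested one slice at a time, because
  the slices are open.\<close>

lemma continuous_map_from_prod_discrete:
  assumes "\<And>y. y \<in> D \<Longrightarrow> continuous_map T U (\<lambda>x. f x y)"
  shows "continuous_map (prod_topology T (discrete_topology D)) U (\<lambda>(x, y). f x y)"
  unfolding continuous_map_def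
proof (intro conjI allI impI)
  show "(\<lambda>(x, y). f x y) \<in> topspace (prod_topology T (discrete_topology D)) \<rightarrow> topspace U"
    using continuous_map_funspace[OF assms] by auto
  fix W assume W: "openin U W"
  let ?P = "{z \<in> topspace (prod_topology T (discrete_topology D)). (\<lambda>(x, y). f x y) z \<in> W}"
  show "openin (prod_topology T (discrete_topology D)) ?P"
    unfolding openin_prod_topology_alt
  proof (intro allI impI)
    fix x y assume xy: "(x, y) \<in> ?P"
    let ?V = "{x \<in> topspace T. f x y \<in> W}"
    have "openin T ?V" using assms[of y] xy W by (auto intro: openin_continuous_map_preimage)
    then show "\<exists>V E. openin T V \<and> openin (discrete_topology D) E \<and> x \<in> V \<and> y \<in> E \<and> V \<times> E \<subseteq> ?P"
      using xy by (intro exI[of _ ?V] exI[of _ "{y}"]) auto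
  qed
qed

lemma closedin_prod_discrete:
  assumes C: "C \<subseteq> topspace T \<times> D"
    and slices: "\<And>y. y \<in> D \<Longrightarrow> closedin T {x. (x, y) \<in> C}"
  shows "closedin (prod_topology T (discrete_topology D)) C"
  unfolding closedin_def openin_prod_topology_alt
proof (intro conjI allI impI)
  show "C \<subseteq> topspace (prod_topology T (discrete_topology D))" using C by simp
  fix x y assume xy: "(x, y) \<in> topspace (prod_topology T (discrete_topology D)) - C"
  let ?V = "topspace T - {x. (x, y) \<in> C}"
  have "openin T ?V" using slices[of y] xy by auto
  then show "\<exists>V E. openin T V \<and> openin (discrete_topology D) E \<and> x \<in> V \<and> y \<in> E \<and>
      V \<times> E \<subseteq> topspace (prod_topology T (discrete_topology D)) - C"
    using xy by (intro exI[of _ ?V] exI[of _ "{y}"]) auto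
qed

lemma (in group_hom) the_elem_kernel_coset:
  assumes "g \<in> carrier G"
  shows "the_elem (h ` (kernel G H h #> g)) = h g"
proof -
  have "h ` (kernel G H h #> g) = {h g}"
    using assms by (auto simp: kernel_def r_coset_def intro!: imageI)
  then show ?thesis by simp
qed

text \<open>The group acts on the right, and \<open>(a, g)\<close> stands for the product \<open>g a\<close>: then
  \<open>(g a) (h b) = g h a\<^sup>h b\<close> involves no inverses.\<close>

definition semidirect ::
  "('a, 'p) monoid_scheme \<Rightarrow> ('b, 'q) monoid_scheme \<Rightarrow> ('b \<Rightarrow> 'a \<Rightarrow> 'a) \<Rightarrow> ('a \<times> 'b) monoid" where
  "semidirect A G act =
    \<lparr>carrier = carrier A \<times> carrier G,
     mult = (\<lambda>(a, g) (b, h). (act h a \<otimes>\<^bsub>A\<^esub> b, g \<otimes>\<^bsub>G\<^esub> h)),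
     one = (\<one>\<^bsub>A\<^esub>, \<one>\<^bsub>G\<^esub>)\<rparr>"

lemma semidirect_simps [simp]:
  "carrier (semidirect A G act) = carrier A \<times> carrier G"
  "(a, g) \<otimes>\<^bsub>semidirect A G act\<^esub> (b, h) = (act h a \<otimes>\<^bsub>A\<^esub> b, g \<otimes>\<^bsub>G\<^esub> h)"
  "\<one>\<^bsub>semidirect A G act\<^esub> = (\<one>\<^bsub>A\<^esub>, \<one>\<^bsub>G\<^esub>)"
  by (simp_all add: semidirect_def)

locale right_action_by_automorphisms = A: group A + G: group G
  for A :: "('a, 'p) monoid_scheme" (structure)
    and G :: "('b, 'q) monoid_scheme" (structure)
    and act :: "'b \<Rightarrow> 'a \<Rightarrow> 'a" +
  assumes act_hom: "g \<in> carrier G \<Longrightarrow> act g \<in> hom A A"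
    and act_one: "a \<in> carrier A \<Longrightarrow> act \<one>\<^bsub>G\<^esub> a = a"
    and act_mult: "\<lbrakk>a \<in> carrier A; g \<in> carrier G; h \<in> carrier G\<rbrakk> \<Longrightarrow>
          act (g \<otimes>\<^bsub>G\<^esub> h) a = act h (act g a)"
begin

lemma group_hom_act: "g \<in> carrier G \<Longrightarrow> group_hom A A (act g)"
  using act_hom by (simp add: group_hom_def group_hom_axioms_def)

lemma act_closed [simp]: "g \<in> carrier G \<Longrightarrow> a \<in> carrier A \<Longrightarrow> act g a \<in> carrier A"
  by (rule hom_in_carrier[OF act_hom])

lemma act_distrib:
  "g \<in> carrier G \<Longrightarrow> a \<in> carrier A \<Longrightarrow> b \<in> carrier A \<Longrightarrow> act g (a \<otimes> b) = act g a \<otimes> act g b"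
  by (rule hom_mult[OF act_hom])

lemma act_unit: "g \<in> carrier G \<Longrightarrow> act g \<one> = \<one>"
  using group_hom.hom_one[OF group_hom_act] .

lemma act_inv: "g \<in> carrier G \<Longrightarrow> a \<in> carrier A \<Longrightarrow> act g (inv a) = inv (act g a)"
  using group_hom.hom_inv[OF group_hom_act] .

abbreviation Y where "Y \<equiv> semidirect A G act"

lemma group_semidirect: "group Y"
proof (rule groupI)
  fix x assume "x \<in> carrier Y"
  then obtain a g where x: "x = (a, g)" "a \<in> carrier A" "g \<in> carrier G" by auto
  show "\<one>\<^bsub>Y\<^esub> \<otimes>\<^bsub>Y\<^esub> x = x" using x by (simp add: act_unit)
  show "\<exists>y\<in>carrier Y. y \<otimes>\<^bsub>Y\<^esub> x = \<one>\<^bsub>Y\<^esub>"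
    by (rule bexI[of _ "(act (inv\<^bsub>G\<^esub> g) (inv a), inv\<^bsub>G\<^esub> g)"])
      (use x in \<open>simp_all add: act_one flip: act_mult\<close>)
qed (auto simp: act_distrib act_mult A.m_assoc G.m_assoc)

lemma inv_semidirect:
  assumes "a \<in> carrier A" "g \<in> carrier G"
  shows "inv\<^bsub>Y\<^esub> (a, g) = (act (inv\<^bsub>G\<^esub> g) (inv a), inv\<^bsub>G\<^esub> g)"
  using assms by (intro group.inv_equality[OF group_semidirect]) (simp_all add: act_one flip: act_mult)

lemma group_hom_semidirect_snd: "group_hom Y G snd"
  using group_semidirect by (auto simp: group_hom_def group_hom_axioms_def intro!: homI)

end

text \<open>A discrete group acting continuously on a contractible topological group: the components of
  the semidirect product are the fibres over \<open>G\<close>, all of them copies of \<open>A\<close>.\<close>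

locale contractible_semidirect =
  right_action_by_automorphisms A G act + T: topological_group A T
  for A :: "('a, 'p) monoid_scheme" (structure)
    and G :: "('b, 'q) monoid_scheme" (structure)
    and act :: "'b \<Rightarrow> 'a \<Rightarrow> 'a" and T :: "'a topology" +
  assumes continuous_act: "g \<in> carrier G \<Longrightarrow> continuous_map T T (act g)"
    and contractible: "contractible_space T"
begin

abbreviation S where "S \<equiv> prod_topology T (discrete_topology (carrier G))"

lemma topological_group_semidirect: "topological_group Y S"
proof -
  interpret Y: group Y by (rule group_semidirect)
  let ?D = "discrete_topology (carrier G)"
  have act: "continuous_map S T (\<lambda>(a, h). act h a)"
    by (rule continuous_map_from_prod_discrete) (rule continuous_act)
  show ?thesis
  proof
    show "topspace S = carrier Y" by (simp add: T.topspace_eq)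
  next
    have fst1: "continuous_map (prod_topology S S) T (\<lambda>p. fst (fst p))"
      and snd1: "continuous_map (prod_topology S S) ?D (\<lambda>p. snd (fst p))"
      and fst2: "continuous_map (prod_topology S S) T (\<lambda>p. fst (snd p))"
      and snd2: "continuous_map (prod_topology S S) ?D (\<lambda>p. snd (snd p))"
      by (rule continuous_map_compose[OF continuous_map_fst continuous_map_fst, unfolded o_def]
          continuous_map_compose[OF continuous_map_fst continuous_map_snd, unfolded o_def]
          continuous_map_compose[OF continuous_map_snd continuous_map_fst, unfolded o_def]
          continuous_map_compose[OF continuous_map_snd continuous_map_snd, unfolded o_def])+
    have "continuous_map (prod_topology S S) T
        ((\<lambda>(a, h). act h a) \<circ> (\<lambda>p. (fst (fst p), snd (snd p))))"
      using act by (intro continuous_map_compose[OF continuous_map_pairedI[OF fst1 snd2]])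
    then have "continuous_map (prod_topology S S) T
        (\<lambda>p. act (snd (snd p)) (fst (fst p)) \<otimes> fst (snd p))"
      using fst2 by (intro T.continuous_map_mult) (simp_all add: o_def)
    moreover have "continuous_map (prod_topology ?D ?D) ?D (\<lambda>(g, h). g \<otimes>\<^bsub>G\<^esub> h)"
      by (simp flip: prod_topology_discrete_topology) auto
    from continuous_map_compose[OF continuous_map_pairedI[OF snd1 snd2] this]
    have "continuous_map (prod_topology S S) ?D (\<lambda>p. snd (fst p) \<otimes>\<^bsub>G\<^esub> snd (snd p))"
      by (simp add: o_def)
    ultimately have "continuous_map (prod_topology S S) S
        (\<lambda>p. (act (snd (snd p)) (fst (fst p)) \<otimes> fst (snd p), snd (fst p) \<otimes>\<^bsub>G\<^esub> snd (snd p)))"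
      by (rule continuous_map_pairedI)
    then show "continuous_map (prod_topology S S) S (\<lambda>(x, y). x \<otimes>\<^bsub>Y\<^esub> y)"
      by (rule continuous_map_eq) auto
  next
    have inv: "continuous_map S ?D (\<lambda>p. inv\<^bsub>G\<^esub> (snd p))"
      using continuous_map_compose[OF continuous_map_snd[of T ?D], of ?D "\<lambda>g. inv\<^bsub>G\<^esub> g"]
      by (auto simp: o_def)
    have "continuous_map S T (\<lambda>p. inv (fst p))"
      using continuous_map_compose[OF continuous_map_fst[of T ?D] T.continuous_inv] by (simp add: o_def)
    from continuous_map_compose[OF continuous_map_pairedI[OF this inv] act]
    have "continuous_map S S (\<lambda>p. (act (inv\<^bsub>G\<^esub> (snd p)) (inv (fst p)), inv\<^bsub>G\<^esub> (snd p)))"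
      using inv by (intro continuous_map_pairedI) (simp_all add: o_def)
    then show "continuous_map S S (\<lambda>x. inv\<^bsub>Y\<^esub> x)"
      by (rule continuous_map_eq) (auto simp: T.topspace_eq inv_semidirect)
  qed
qed

lemma connected_component_fibre:
  "a \<in> carrier A \<Longrightarrow> g \<in> carrier G \<Longrightarrow> connected_component_of_set S (a, g) = carrier A \<times> {g}"
  using contractible_imp_connected_space[OF contractible]
  by (simp add: connected_component_of_pair connected_component_of_discrete_topology
      connected_space_connected_component_set[THEN iffD1] T.topspace_eq)

lemma homotopically_discrete_semidirect: "homotopically_discrete S"
  unfolding homotopically_discrete_def
proof
  fix C assume "C \<in> connected_components_of S"
  then obtain g where g: "g \<in> carrier G" and C: "C = topspace T \<times> {g}"
    by (auto simp: connected_components_of_def connected_component_fibre T.topspace_eq)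
  have "subtopology S C = prod_topology T (discrete_topology {g})"
    using g by (simp add: C subtopology_Times subtopology_discrete_topology)
  then show "contractible_space (subtopology S C)"
    using contractible by (simp add: contractible_space_prod_topology)
qed

lemma identity_component_semidirect: "identity_component Y S = kernel Y G snd"
  by (auto simp: identity_component_def connected_component_fibre kernel_def)

end

section \<open>Realizing a crossed module in a semidirect product\<close>

text \<open>Given a copy \<open>c(N)\<close> of \<open>N\<close> in the contractible group \<open>A\<close>, for which \<open>n(a) \<in> G\<close> acts on all of
  \<open>A\<close> as conjugation by \<open>c(a)\<close>, the element \<open>j(a) = n(a) c(a)\<^sup>-\<^sup>1\<close> of the semidirect product
  centralizes \<open>A\<close>. Therefore \<open>j\<close> is a homomorphism. By (NM1), \<open>G\<close> permutes its values as it does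
  the elements of \<open>N\<close>: \<open>j(a)\<^sup>g = j(a\<^sup>g)\<close>, so that \<open>K = j(N)\<close> is normal. As \<open>c(N)\<close> has only
  closed subsets, \<open>K\<close> is closed and discrete. Therefore \<open>\<pi>\<^sub>0(K) = K \<cong> N\<close>, and the projection to
  \<open>G\<close>, which induces \<open>\<pi>\<^sub>0(Y) \<cong> G\<close>, maps \<open>j(a)\<close> to \<open>n(a)\<close>.\<close>

theorem crossed_module_realization:
  fixes G :: "('b, 'q) monoid_scheme" and N :: "('c, 'r) monoid_scheme" and c :: "'c \<Rightarrow> 'a"
    and A :: "('a, 'p) monoid_scheme"
  assumes "contractible_semidirect A G act T"
    and cm: "crossed_module N G n l"
    and c: "group_hom N A c" and inj: "inj_on c (carrier N)"
    and act_c: "\<And>a g. a \<in> carrier N \<Longrightarrow> g \<in> carrier G \<Longrightarrow> act g (c a) = c (l g a)"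
    and act_n: "\<And>a f. a \<in> carrier N \<Longrightarrow> f \<in> carrier A \<Longrightarrow> act (n a) f = conjugate A f (c a)"
    and closed: "\<And>D. D \<subseteq> c ` carrier N \<Longrightarrow> closedin T D"
  shows "\<exists>(Y :: ('a \<times> 'b) monoid) S K \<alpha> \<beta>.
           topological_group Y S \<and> K \<lhd> Y \<and> closedin S K \<and>
           \<alpha> \<in> iso (pi0_sub Y S K) N \<and> \<beta> \<in> iso (pi0 Y S) G \<and>
           (\<forall>C \<in> carrier (pi0_sub Y S K). \<beta> (pi0_incl Y S C) = n (\<alpha> C)) \<and>
           homotopically_discrete (subtopology S K) \<and> homotopically_discrete S"
proof -
  interpret contractible_semidirect A G act T by fact
  interpret c: group_hom N A c by (rule c)
  interpret n: group_hom N G n using cm by (simp add: crossed_module_def)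
  have n_conj: "n (l g a) = conjugate G (n a) g" if "a \<in> carrier N" "g \<in> carrier G" for a g
    using cm that by (simp add: crossed_module_def)
  have l_closed: "l g a \<in> carrier N" if "a \<in> carrier N" "g \<in> carrier G" for a g
  proof -
    have "l g \<in> carrier (right_AutoGroup N)"
      using cm that by (auto simp: crossed_module_def dest: hom_in_carrier)
    then show ?thesis using that
      by (auto simp: right_AutoGroup_def AutoGroup_def auto_def dest: hom_in_carrier)
  qed
  interpret Y: topological_group Y S by (rule topological_group_semidirect)
  interpret p: group_hom Y G snd by (rule group_hom_semidirect_snd)
  define j where "j = (\<lambda>a. (c (inv\<^bsub>N\<^esub> a), n a))"
  have "j \<in> hom N Y"
    by (rule homI) (auto simp: j_def act_n conjugate_def A.m_assoc c.G.inv_mult_group)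
  then interpret j: group_hom N Y j
    by (simp add: group_hom_def group_hom_axioms_def Y.is_group)
  have j_eq: "c (inv\<^bsub>N\<^esub> a) = c (inv\<^bsub>N\<^esub> b) \<longleftrightarrow> a = b" if "a \<in> carrier N" "b \<in> carrier N" for a b
    using inj that by (metis inj_on_eq_iff c.G.inv_closed c.G.inv_inv)
  have j_inj: "inj_on j (carrier N)"
    using j_eq by (intro inj_onI) (simp add: j_def)
  define K where "K = j ` carrier N"
  have subK: "subgroup K Y" unfolding K_def by (rule j.img_is_subgroup)
  \<comment> \<open>In \<open>Y\<close> the conjugate of \<open>j a\<close> by \<open>y\<close> depends only on the \<open>G\<close>-component of \<open>y\<close>; written without
    inverses.\<close>
  have comm: "j a \<otimes>\<^bsub>Y\<^esub> y = y \<otimes>\<^bsub>Y\<^esub> j (l (snd y) a)" if a: "a \<in> carrier N" and y: "y \<in> carrier Y" for a y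
  proof -
    obtain f g where y': "y = (f, g)" "f \<in> carrier A" "g \<in> carrier G" using y by auto
    let ?b = "l g a"
    have b: "?b \<in> carrier N" using a y' by (simp add: l_closed)
    have "act g (c (inv\<^bsub>N\<^esub> a)) = c (inv\<^bsub>N\<^esub> ?b)"
      using a y' b by (simp add: act_inv act_c)
    moreover have "n a \<otimes>\<^bsub>G\<^esub> g = g \<otimes>\<^bsub>G\<^esub> n ?b"
      using a y' by (simp add: n_conj conjugate_def flip: G.m_assoc)
    ultimately show ?thesis
      using a y' b by (simp add: j_def act_n conjugate_def A.m_assoc)
  qed
  have normal: "K \<lhd> Y"
    unfolding Y.normal_inv_iff
  proof (intro conjI ballI subK)
    fix y k assume y: "y \<in> carrier Y" and "k \<in> K"
    then obtain a where a: "a \<in> carrier N" "k = j a" by (auto simp: K_def)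
    let ?b = "l (snd (inv\<^bsub>Y\<^esub> y)) a"
    have b: "?b \<in> carrier N" using a y by (intro l_closed) (auto simp del: semidirect_simps)
    have "y \<otimes>\<^bsub>Y\<^esub> k \<otimes>\<^bsub>Y\<^esub> inv\<^bsub>Y\<^esub> y = y \<otimes>\<^bsub>Y\<^esub> (inv\<^bsub>Y\<^esub> y \<otimes>\<^bsub>Y\<^esub> j ?b)"
      using comm[OF a(1) Y.inv_closed[OF y]] a y by (simp add: Y.m_assoc del: semidirect_simps)
    also have "\<dots> = j ?b"
      using y b by (simp del: semidirect_simps flip: Y.m_assoc)
    finally show "y \<otimes>\<^bsub>Y\<^esub> k \<otimes>\<^bsub>Y\<^esub> inv\<^bsub>Y\<^esub> y \<in> K" using b by (simp add: K_def)
  qed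
  have closed_sub: "closedin S D" if D: "D \<subseteq> K" for D
  proof (rule closedin_prod_discrete)
    have "K \<subseteq> carrier Y" using subK by (rule subgroup.subset)
    then show "D \<subseteq> topspace T \<times> carrier G" using D by (auto simp: T.topspace_eq)
    show "closedin T {x. (x, y) \<in> D}" for y
    proof (rule closed, safe)
      fix x assume "(x, y) \<in> D"
      then obtain a where "a \<in> carrier N" "x = c (inv\<^bsub>N\<^esub> a)" using D by (auto simp: K_def j_def)
      then show "x \<in> c ` carrier N" by blast
    qed
  qed
  have discrete: "subtopology S K = discrete_topology K"
  proof -
    have "K \<subseteq> topspace S" using closed_sub[of K] closedin_subset by blast
    moreover have "openin (subtopology S K) {k}" if k: "k \<in> K" for k
    proof -
      have "closedin (subtopology S K) (K - {k})"
        by (rule closedin_subset_topspace) (auto intro: closed_sub)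
      moreover have "topspace (subtopology S K) - (K - {k}) = {k}"
        using k \<open>K \<subseteq> topspace S\<close> by auto
      ultimately show ?thesis by (metis openin_closedin_eq closedin_def double_diff openin_diff openin_topspace)
    qed
    ultimately show ?thesis by (metis discrete_topology_unique topspace_subtopology_subset)
  qed
  let ?K = "Y\<lparr>carrier := K\<rparr>"
  interpret K: topological_group ?K "subtopology S K"
    by (rule Y.topological_group_subgroup[OF subK])
  define h where "h = inv_into (carrier N) j"
  have h_j: "h (j a) = a" if "a \<in> carrier N" for a using that j_inj by (simp add: h_def)
  have "h \<in> hom ?K N"
  proof (rule homI)
    fix x y assume "x \<in> carrier ?K" "y \<in> carrier ?K"
    then obtain a b where "a \<in> carrier N" "x = j a" "b \<in> carrier N" "y = j b" by (auto simp: K_def)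
    then show "h (x \<otimes>\<^bsub>?K\<^esub> y) = h x \<otimes>\<^bsub>N\<^esub> h y" by (simp add: h_j flip: j.hom_mult)
  qed (auto simp: K_def h_j)
  then interpret h: group_hom ?K N h by (simp add: group_hom_def group_hom_axioms_def K.is_group c.G.is_group)
  have ker_h: "kernel ?K N h = identity_component ?K (subtopology S K)"
  proof -
    have "kernel ?K N h = {j \<one>\<^bsub>N\<^esub>}" by (auto simp: kernel_def K_def h_j simp del: j.hom_one)
    moreover have "\<one>\<^bsub>Y\<^esub> \<in> K" using subK by (rule subgroup.one_closed)
    ultimately show ?thesis
      by (simp add: identity_component_def discrete connected_component_of_discrete_topology)
  qed
  let ?\<alpha> = "\<lambda>C. the_elem (h ` C)" and ?\<beta> = "\<lambda>C. the_elem (snd ` C)"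
  have \<alpha>: "?\<alpha> \<in> iso (pi0_sub Y S K) N"
  proof -
    have "h ` carrier ?K = carrier N" by (force simp: K_def h_j)
    from h.FactGroup_iso_set[OF this] show ?thesis by (simp add: pi0_def ker_h)
  qed
  have \<beta>: "?\<beta> \<in> iso (pi0 Y S) G"
  proof -
    have "snd ` carrier Y = carrier G" using A.one_closed by force
    from p.FactGroup_iso_set[OF this] show ?thesis by (simp add: pi0_def identity_component_semidirect)
  qed
  have square: "?\<beta> (pi0_incl Y S C) = n (?\<alpha> C)" if C_in: "C \<in> carrier (pi0_sub Y S K)" for C
  proof -
    obtain k where "k \<in> carrier ?K"
      and "C = identity_component ?K (subtopology S K) #>\<^bsub>?K\<^esub> k"
      using C_in unfolding K.carrier_pi0 by (rule imageE)
    then obtain a where a: "a \<in> carrier N"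
      and C: "C = identity_component ?K (subtopology S K) #>\<^bsub>?K\<^esub> j a"
      unfolding K_def by fastforce
    have ja: "j a \<in> K" using a by (simp add: K_def)
    have "?\<beta> (pi0_incl Y S C) = snd (j a)"
      unfolding C Y.pi0_incl_coset[OF subK ja] identity_component_semidirect
      using a by (intro p.the_elem_kernel_coset) (rule j.hom_closed)
    moreover have "?\<alpha> C = h (j a)"
      unfolding C ker_h[symmetric] using ja by (intro h.the_elem_kernel_coset) simp
    ultimately show ?thesis using a by (simp add: h_j) (simp add: j_def)
  qed
  have "homotopically_discrete (subtopology S K)"
    by (auto simp: discrete homotopically_discrete_def connected_components_of_discrete_topology
        subtopology_discrete_topology)
  then show ?thesis
    using Y.topological_group_axioms normal closed_sub[of K] \<alpha> \<beta> square homotopically_discrete_semidirect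
    by blast
qed


section \<open>The contractible group of step functions\<close>

lemma continuous_map_nonexpansive_pair:
  assumes "Metric_space A dA" and "Metric_space B dB" and "Metric_space C dC"
    and F: "\<And>a b. a \<in> A \<Longrightarrow> b \<in> B \<Longrightarrow> F a b \<in> C"
    and le: "\<And>a b a' b'. a \<in> A \<Longrightarrow> b \<in> B \<Longrightarrow> a' \<in> A \<Longrightarrow> b' \<in> B \<Longrightarrow>
      dC (F a b) (F a' b') \<le> dA a a' + dB b b'"
  shows "continuous_map
    (prod_topology (Metric_space.mtopology A dA) (Metric_space.mtopology B dB))
    (Metric_space.mtopology C dC) (\<lambda>(a, b). F a b)"
proof -
  interpret A: Metric_space A dA by fact
  interpret B: Metric_space B dB by fact
  interpret C: Metric_space C dC by fact
  show ?thesis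
    unfolding C.continuous_map_to_metric
  proof (intro ballI allI impI)
    fix p and e :: real
    assume p: "p \<in> topspace (prod_topology A.mtopology B.mtopology)" and e: "e > 0"
    obtain a b where p': "p = (a, b)" "a \<in> A" "b \<in> B" using p by auto
    let ?U = "A.mball a (e/2) \<times> B.mball b (e/2)"
    have "openin (prod_topology A.mtopology B.mtopology) ?U"
      by (simp add: openin_prod_Times_iff)
    moreover have "(case q of (a, b) \<Rightarrow> F a b) \<in> C.mball (case p of (a, b) \<Rightarrow> F a b) e" if qU: "q \<in> ?U" for q
    proof -
      obtain a' b' where q: "q = (a', b')" "a' \<in> A" "b' \<in> B" "dA a a' < e/2" "dB b b' < e/2"
        using qU by auto
      then show ?thesis using le[of a b a' b'] F p' by auto
    qed
    ultimately show "\<exists>U. openin (prod_topology A.mtopology B.mtopology) U \<and> p \<in> U \<and>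
        (\<forall>q\<in>U. (case q of (a, b) \<Rightarrow> F a b) \<in> C.mball (case p of (a, b) \<Rightarrow> F a b) e)"
      using p' e by (intro exI[of _ ?U]) auto
  qed
qed

text \<open>A half-radius ball around a point contains at most one point of a set whose points are at
  mutual distance at least one, so the set has no accumulation points.\<close>

lemma (in Metric_space) closedin_separated:
  assumes D: "D \<subseteq> M" and sep: "\<And>x y. x \<in> D \<Longrightarrow> y \<in> D \<Longrightarrow> x \<noteq> y \<Longrightarrow> 1 \<le> d x y"
  shows "closedin mtopology D"
  unfolding closedin_metric
proof (intro conjI allI impI D)
  fix x assume x: "x \<in> M - D"
  show "\<exists>r>0. disjnt D (mball x r)"
  proof (cases "disjnt D (mball x (1/2))")
    case False
    then obtain y where y: "y \<in> D" "d x y < 1/2" by (auto simp: disjnt_iff)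
    have "z = y" if "z \<in> D" "d x z < 1/2" for z
      using sep[of z y] triangle[of z x y] that y x D commute[of x z] by fastforce
    then have "disjnt D (mball x (min (d x y) (1/2)))" by (auto simp: disjnt_iff)
    moreover have "0 < d x y" using x y D by auto
    ultimately show ?thesis by (intro exI[of _ "min (d x y) (1/2)"]) auto
  qed (intro exI[of _ "1/2"]; simp)
qed

text \<open>A variant of the group of Hartman and Mycielski for a discrete group \<open>N\<close>: functions from
  \<open>[0, 1)\<close> to \<open>N\<close> under pointwise multiplication, here extended by \<open>\<one>\<close> to the real line, with
  finite range but possibly infinitely many jumps. Constancy to the right of every point
  prevents two distinct functions from agreeing almost everywhere; finiteness of the range and
  measurability make the set on which two functions differ measurable.\<close>

definition step_functions :: "('a, 'p) monoid_scheme \<Rightarrow> (real \<Rightarrow> 'a) monoid" where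
  "step_functions N =
    \<lparr>carrier = {f. simple_function lborel f \<and> range f \<subseteq> carrier N \<and>
       (\<forall>x. x \<notin> {0..<1} \<longrightarrow> f x = \<one>\<^bsub>N\<^esub>) \<and> (\<forall>x. \<forall>\<^sub>F y in at_right x. f y = f x)},
     mult = (\<lambda>f g x. f x \<otimes>\<^bsub>N\<^esub> g x),
     one = (\<lambda>x. \<one>\<^bsub>N\<^esub>)\<rparr>"

definition step_dist :: "(real \<Rightarrow> 'a) \<Rightarrow> (real \<Rightarrow> 'a) \<Rightarrow> real" where
  "step_dist f g = measure lborel {x. f x \<noteq> g x}"

definition step_const :: "('a, 'p) monoid_scheme \<Rightarrow> 'a \<Rightarrow> real \<Rightarrow> 'a" where
  "step_const N a x = (if x \<in> {0..<1} then a else \<one>\<^bsub>N\<^esub>)"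

definition step_truncate :: "('a, 'p) monoid_scheme \<Rightarrow> real \<Rightarrow> (real \<Rightarrow> 'a) \<Rightarrow> real \<Rightarrow> 'a" where
  "step_truncate N t f x = (if x < t then \<one>\<^bsub>N\<^esub> else f x)"

abbreviation step_topology :: "('a, 'p) monoid_scheme \<Rightarrow> (real \<Rightarrow> 'a) topology" where
  "step_topology N \<equiv> Metric_space.mtopology (carrier (step_functions N)) step_dist"

lemma step_functions_mult [simp]: "(f \<otimes>\<^bsub>step_functions N\<^esub> g) = (\<lambda>x. f x \<otimes>\<^bsub>N\<^esub> g x)"
  by (simp add: step_functions_def)

lemma step_functions_one [simp]: "\<one>\<^bsub>step_functions N\<^esub> = (\<lambda>x. \<one>\<^bsub>N\<^esub>)"
  by (simp add: step_functions_def)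

lemma step_functionsD:
  assumes "f \<in> carrier (step_functions N)"
  shows "simple_function lborel f" "f x \<in> carrier N" "x \<notin> {0..<1} \<Longrightarrow> f x = \<one>\<^bsub>N\<^esub>"
    "\<forall>\<^sub>F y in at_right x. f y = f x"
  using assms by (auto simp: step_functions_def)

lemma step_functions_eqI:
  assumes "f \<in> carrier (step_functions N)" "g \<in> carrier (step_functions N)"
    and "\<And>x. x \<in> {0..<1} \<Longrightarrow> f x = g x"
  shows "f = g"
  using assms step_functionsD(3) by (metis ext)

text \<open>Products, inverses and the action of automorphisms are all computed pointwise, so that this
  gives closure under each of them.\<close>

lemma step_functions_map2:
  assumes f: "f \<in> carrier (step_functions N)" and g: "g \<in> carrier (step_functions N')"
    and op: "\<And>a b. a \<in> carrier N \<Longrightarrow> b \<in> carrier N' \<Longrightarrow> op a b \<in> carrier L"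
    and op_one: "op \<one>\<^bsub>N\<^esub> \<one>\<^bsub>N'\<^esub> = \<one>\<^bsub>L\<^esub>"
  shows "(\<lambda>x. op (f x) (g x)) \<in> carrier (step_functions L)"
proof -
  have "\<forall>\<^sub>F y in at_right x. op (f y) (g y) = op (f x) (g x)" for x
    using step_functionsD(4)[OF f, of x] step_functionsD(4)[OF g, of x]
    by eventually_elim simp
  moreover have "simple_function lborel (\<lambda>x. op (f x) (g x))"
    using step_functionsD(1)[OF f] step_functionsD(1)[OF g] by (rule simple_function_compose2)
  ultimately show ?thesis
    using op op_one step_functionsD(2,3)[OF f] step_functionsD(2,3)[OF g]
    by (auto simp: step_functions_def)
qed

lemma step_functions_map:
  assumes f: "f \<in> carrier (step_functions N)"
    and op: "\<And>a. a \<in> carrier N \<Longrightarrow> op a \<in> carrier L" and op_one: "op \<one>\<^bsub>N\<^esub> = \<one>\<^bsub>L\<^esub>"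
  shows "(\<lambda>x. op (f x)) \<in> carrier (step_functions L)"
  using step_functions_map2[OF f f, of "\<lambda>a b. op a" L] op op_one by simp

lemma eventually_at_right_less_cong:
  fixes x t :: real
  shows "\<forall>\<^sub>F y in at_right x. (y < t) = (x < t)"
proof (cases "x < t")
  case True
  then show ?thesis by (auto simp: eventually_at_right_field)
next
  case False
  then show ?thesis by (auto simp: eventually_at_right_field intro: exI[of _ "x + 1"])
qed

lemma step_const_closed:
  assumes a: "a \<in> carrier N" and one: "\<one>\<^bsub>N\<^esub> \<in> carrier N"
  shows "step_const N a \<in> carrier (step_functions N)"
proof -
  have "\<forall>\<^sub>F y in at_right x. step_const N a y = step_const N a x" for x
    using eventually_at_right_less_cong[where x = x and t = 0] eventually_at_right_less_cong[where x = x and t = 1]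
    by eventually_elim (auto simp: step_const_def not_less[symmetric])
  moreover have "simple_function lborel (\<lambda>x::real. if x \<in> {0..<1} then a else \<one>\<^bsub>N\<^esub>)"
    by (rule simple_function_If_set) simp_all
  then have "simple_function lborel (step_const N a)"
    by (simp add: step_const_def[abs_def])
  ultimately show ?thesis
    using a one by (auto simp: step_functions_def step_const_def)
qed

lemma step_truncate_closed:
  assumes f: "f \<in> carrier (step_functions N)" and one: "\<one>\<^bsub>N\<^esub> \<in> carrier N"
  shows "step_truncate N t f \<in> carrier (step_functions N)"
proof -
  have "\<forall>\<^sub>F y in at_right x. step_truncate N t f y = step_truncate N t f x" for x
    using eventually_at_right_less_cong[where x = x and t = t] step_functionsD(4)[OF f, of x]
    by eventually_elim (simp add: step_truncate_def)
  moreover have "simple_function lborel (\<lambda>x. if x \<in> {..<t} then \<one>\<^bsub>N\<^esub> else f x)"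
    using step_functionsD(1)[OF f] by (intro simple_function_If_set) auto
  then have "simple_function lborel (step_truncate N t f)"
    by (simp add: step_truncate_def[abs_def])
  ultimately show ?thesis
    using one step_functionsD(2,3)[OF f] by (auto simp: step_functions_def step_truncate_def)
qed

lemma disagreement_fmeasurable:
  assumes f: "f \<in> carrier (step_functions N)" and g: "g \<in> carrier (step_functions N)"
  shows "{x. f x \<noteq> g x} \<in> fmeasurable lborel"
proof -
  have "simple_function lborel (\<lambda>x. f x \<noteq> g x)"
    using step_functionsD(1)[OF f] step_functionsD(1)[OF g] by (rule simple_function_compose2)
  from simple_functionD(2)[OF this, of "{True}"] have "{x. f x \<noteq> g x} \<in> sets lborel"
    by (simp add: vimage_def)
  moreover have "{x. f x \<noteq> g x} \<subseteq> {0..1}"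
    using step_functionsD(3)[OF f] step_functionsD(3)[OF g] by fastforce
  moreover have "{0..1::real} \<in> fmeasurable lborel" by (simp add: fmeasurable_def)
  ultimately show ?thesis by (meson fmeasurableI2)
qed

lemma step_dist_const:
  assumes "a \<noteq> b"
  shows "step_dist (step_const N a) (step_const N b) = 1"
proof -
  have "{x. step_const N a x \<noteq> step_const N b x} = {0..<1}"
    using assms by (auto simp: step_const_def)
  then show ?thesis by (simp add: step_dist_def)
qed

lemma step_dist_le:
  assumes "f' \<in> carrier (step_functions N)" "g' \<in> carrier (step_functions N)"
    and "f \<in> carrier (step_functions L)" "g \<in> carrier (step_functions L)"
    and "\<And>x. f x = g x \<Longrightarrow> f' x = g' x"
  shows "step_dist f' g' \<le> step_dist f g"
  unfolding step_dist_def
  using assms disagreement_fmeasurable[of f' N g'] disagreement_fmeasurable[of f L g]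
  by (intro measure_mono_fmeasurable) auto

text \<open>With \<open>B\<close> the set on which another pair of functions differs, this is the triangle inequality and
  the estimate for products; with \<open>B\<close> an interval it is the estimate for truncations at
  different points.\<close>

lemma step_dist_le_add:
  assumes pq: "p \<in> carrier (step_functions N)" "q \<in> carrier (step_functions N)"
    and fg: "f \<in> carrier (step_functions N)" "g \<in> carrier (step_functions N)"
    and B: "B \<in> fmeasurable lborel"
    and eq: "\<And>x. f x = g x \<Longrightarrow> x \<notin> B \<Longrightarrow> p x = q x"
  shows "step_dist p q \<le> measure lborel B + step_dist f g"
proof -
  have "step_dist p q \<le> measure lborel (B \<union> {x. f x \<noteq> g x})"
    unfolding step_dist_def
  proof (rule measure_mono_fmeasurable)
    show "{x. p x \<noteq> q x} \<subseteq> B \<union> {x. f x \<noteq> g x}" using eq by blast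
    show "{x. p x \<noteq> q x} \<in> sets lborel" by (rule fmeasurableD[OF disagreement_fmeasurable[OF pq]])
    show "B \<union> {x. f x \<noteq> g x} \<in> fmeasurable lborel"
      using B disagreement_fmeasurable[OF fg] by (rule fmeasurable.Un)
  qed
  also have "\<dots> \<le> measure lborel B + step_dist f g"
    unfolding step_dist_def
    by (rule measure_Un_le[OF fmeasurableD[OF B] fmeasurableD[OF disagreement_fmeasurable[OF fg]]])
  finally show ?thesis .
qed

lemma Metric_space_step_functions: "Metric_space (carrier (step_functions N)) step_dist"
proof
  show "0 \<le> step_dist f g" for f g :: "real \<Rightarrow> 'a" by (simp add: step_dist_def)
  show "step_dist f g = step_dist g f" for f g :: "real \<Rightarrow> 'a"
    by (simp add: step_dist_def eq_commute)
next
  fix f g assume fg: "f \<in> carrier (step_functions N)" "g \<in> carrier (step_functions N)"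
  show "step_dist f g = 0 \<longleftrightarrow> f = g"
  proof
    assume 0: "step_dist f g = 0"
    show "f = g"
    proof (rule ccontr)
      assume "f \<noteq> g"
      then obtain x where x: "f x \<noteq> g x" by auto
      have "\<forall>\<^sub>F y in at_right x. f y \<noteq> g y"
        using step_functionsD(4)[OF fg(1), of x] step_functionsD(4)[OF fg(2), of x]
        by eventually_elim (use x in simp)
      then obtain b where "x < b" "\<forall>y>x. y < b \<longrightarrow> f y \<noteq> g y"
        unfolding eventually_at_right_field by auto
      then have b: "x < b" "{x<..<b} \<subseteq> {y. f y \<noteq> g y}" by auto
      have "b - x = measure lborel {x<..<b}" using b by simp
      also have "\<dots> \<le> step_dist f g"
        unfolding step_dist_def using b disagreement_fmeasurable[OF fg]
        by (intro measure_mono_fmeasurable) auto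
      finally show False using 0 b by simp
    qed
  qed (simp add: step_dist_def)
next
  fix f g h assume fgh: "f \<in> carrier (step_functions N)" "g \<in> carrier (step_functions N)"
    "h \<in> carrier (step_functions N)"
  have "step_dist f h \<le> measure lborel {x. f x \<noteq> g x} + step_dist g h"
    using fgh by (intro step_dist_le_add[of _ N] disagreement_fmeasurable[of _ N]) auto
  then show "step_dist f h \<le> step_dist f g + step_dist g h" by (simp add: step_dist_def)
qed

lemma topspace_step_topology [simp]: "topspace (step_topology N) = carrier (step_functions N)"
  by (rule Metric_space.topspace_mtopology[OF Metric_space_step_functions])

lemma step_nonexpansive_continuous:
  assumes "\<And>f. f \<in> carrier (step_functions N) \<Longrightarrow> F f \<in> carrier (step_functions L)"
    and "\<And>f g. f \<in> carrier (step_functions N) \<Longrightarrow> g \<in> carrier (step_functions N) \<Longrightarrow>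
      step_dist (F f) (F g) \<le> step_dist f g"
  shows "continuous_map (step_topology N) (step_topology L) F"
proof -
  have "continuous_map (prod_topology (step_topology N) (step_topology N)) (step_topology L) (\<lambda>(f, g). F f)"
  proof (intro continuous_map_nonexpansive_pair Metric_space_step_functions)
    fix f g f' g' assume "f \<in> carrier (step_functions N)" "f' \<in> carrier (step_functions N)"
    then have "step_dist (F f) (F f') \<le> step_dist f f'" by (rule assms(2))
    moreover have "0 \<le> step_dist g g'" by (simp add: step_dist_def)
    ultimately show "step_dist (F f) (F f') \<le> step_dist f f' + step_dist g g'" by linarith
  qed (rule assms(1))
  moreover have "continuous_map (step_topology N) (prod_topology (step_topology N) (step_topology N)) (\<lambda>f. (f, f))"
    by (intro continuous_map_pairedI) auto
  ultimately have "continuous_map (step_topology N) (step_topology L) ((\<lambda>(f, g). F f) \<circ> (\<lambda>f. (f, f)))"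
    by (rule continuous_map_compose[rotated])
  then show ?thesis by (simp add: o_def)
qed

text \<open>Distinct constants differ on all of \<open>[0, 1)\<close>, so they are at distance one.\<close>

lemma closedin_step_constants:
  assumes "D \<subseteq> step_const N ` carrier N" "\<one>\<^bsub>N\<^esub> \<in> carrier N"
  shows "closedin (step_topology N) D"
proof (rule Metric_space.closedin_separated[OF Metric_space_step_functions])
  have "step_const N ` carrier N \<subseteq> carrier (step_functions N)"
    using assms(2) by (auto simp: step_const_closed)
  with assms(1) show "D \<subseteq> carrier (step_functions N)" by (rule order_trans)
  fix f g assume "f \<in> D" "g \<in> D" "f \<noteq> g"
  then obtain a b where "f = step_const N a" "g = step_const N b" "a \<noteq> b"
    using assms(1) by (metis imageE subsetD)
  then show "1 \<le> step_dist f g" by (simp add: step_dist_const)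
qed

context group
begin

lemma group_step_functions: "group (step_functions G)"
proof (rule groupI)
  show "f \<otimes>\<^bsub>step_functions G\<^esub> g \<in> carrier (step_functions G)"
    if "f \<in> carrier (step_functions G)" "g \<in> carrier (step_functions G)" for f g
    using step_functions_map2[OF that, of "(\<otimes>)" G] by simp
  show "\<one>\<^bsub>step_functions G\<^esub> \<in> carrier (step_functions G)"
    using step_const_closed[of \<one> G] by (simp add: step_const_def[abs_def])
next
  fix f assume f: "f \<in> carrier (step_functions G)"
  show "\<one>\<^bsub>step_functions G\<^esub> \<otimes>\<^bsub>step_functions G\<^esub> f = f"
    using step_functionsD(2)[OF f] by simp
  show "\<exists>g\<in>carrier (step_functions G). g \<otimes>\<^bsub>step_functions G\<^esub> f = \<one>\<^bsub>step_functions G\<^esub>"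
    using step_functionsD(2)[OF f] step_functions_map[OF f, of "\<lambda>a. inv a" G]
    by (intro bexI[of _ "\<lambda>x. inv (f x)"]) simp_all
qed (simp add: step_functionsD(2) m_assoc)

lemma inv_step_functions:
  assumes f: "f \<in> carrier (step_functions G)"
  shows "inv\<^bsub>step_functions G\<^esub> f = (\<lambda>x. inv (f x))"
  using f step_functionsD(2)[OF f] step_functions_map[OF f, of "\<lambda>a. inv a" G]
  by (intro group.inv_equality[OF group_step_functions]) simp_all

lemma topological_group_step_functions: "topological_group (step_functions G) (step_topology G)"
proof -
  interpret E: group "step_functions G" by (rule group_step_functions)
  interpret E: Metric_space "carrier (step_functions G)" step_dist
    by (rule Metric_space_step_functions)
  show ?thesis
  proof
    show "continuous_map (prod_topology (step_topology G) (step_topology G)) (step_topology G)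
        (\<lambda>(f, g). f \<otimes>\<^bsub>step_functions G\<^esub> g)"
    proof (rule continuous_map_nonexpansive_pair)
      fix f g f' g'
      assume *: "f \<in> carrier (step_functions G)" "g \<in> carrier (step_functions G)"
         "f' \<in> carrier (step_functions G)" "g' \<in> carrier (step_functions G)"
      show "step_dist (f \<otimes>\<^bsub>step_functions G\<^esub> g) (f' \<otimes>\<^bsub>step_functions G\<^esub> g')
          \<le> step_dist f f' + step_dist g g'"
        using step_dist_le_add[OF E.m_closed[OF *(1,2)] E.m_closed[OF *(3,4)] *(2,4)
            disagreement_fmeasurable[OF *(1,3)]]
        by (simp add: step_dist_def)
    qed (rule Metric_space_step_functions E.m_closed; assumption?)+
    have "continuous_map (step_topology G) (step_topology G) (\<lambda>f x. inv (f x))"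
    proof (rule step_nonexpansive_continuous)
      show inv_closed: "(\<lambda>x. inv (f x)) \<in> carrier (step_functions G)"
        if "f \<in> carrier (step_functions G)" for f
        using step_functions_map[OF that, of "\<lambda>a. inv a" G] by simp
      show "step_dist (\<lambda>x. inv (f x)) (\<lambda>x. inv (g x)) \<le> step_dist f g"
        if "f \<in> carrier (step_functions G)" "g \<in> carrier (step_functions G)" for f g
        by (rule step_dist_le[OF inv_closed[OF that(1)] inv_closed[OF that(2)] that]) simp
    qed
    then show "continuous_map (step_topology G) (step_topology G) (\<lambda>f. inv\<^bsub>step_functions G\<^esub> f)"
      by (rule continuous_map_eq) (simp add: inv_step_functions)
  qed simp
qed

text \<open>The contraction replaces \<open>f\<close> by \<open>\<one>\<close> on \<open>[0, t)\<close>. Truncations at \<open>s\<close> and \<open>t\<close> differ by at most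
  \<open>\<bar>s - t\<bar>\<close> more than the functions themselves, which is joint continuity.\<close>

lemma contractible_step_functions: "contractible_space (step_topology G)"
proof -
  have "continuous_map (prod_topology euclideanreal (step_topology G)) (step_topology G)
      (\<lambda>(t, f). step_truncate G t f)"
    unfolding mtopology_is_euclidean[symmetric]
  proof (rule continuous_map_nonexpansive_pair)
    fix s t :: real and f g
    assume fg: "f \<in> carrier (step_functions G)" "g \<in> carrier (step_functions G)"
    have "step_dist (step_truncate G s f) (step_truncate G t g)
        \<le> measure lborel {min s t..<max s t} + step_dist f g"
    proof (rule step_dist_le_add)
      show "step_truncate G s f \<in> carrier (step_functions G)"
        "step_truncate G t g \<in> carrier (step_functions G)"
        using fg by (simp_all add: step_truncate_closed)
      show "{min s t..<max s t} \<in> fmeasurable lborel" by (simp add: fmeasurable_def)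
      show "step_truncate G s f x = step_truncate G t g x"
        if "f x = g x" "x \<notin> {min s t..<max s t}" for x
        using that by (auto simp: step_truncate_def min_def max_def split: if_splits)
    qed (rule fg)+
    also have "measure lborel {min s t..<max s t} = dist s t"
      by (simp add: dist_real_def)
    finally show "step_dist (step_truncate G s f) (step_truncate G t g) \<le> dist s t + step_dist f g" .
  qed (rule Metric_space_step_functions Met_TC.Metric_space_axioms step_truncate_closed one_closed; assumption?)+
  from continuous_map_from_subtopology[OF this, of "{0..1} \<times> carrier (step_functions G)"]
  have "continuous_map (prod_topology (top_of_set {0..1}) (step_topology G)) (step_topology G)
      (\<lambda>(t, f). step_truncate G t f)"
    by (simp add: prod_topology_subtopology)
  moreover have "step_truncate G 0 f = f" "step_truncate G 1 f = (\<lambda>x. \<one>)"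
    if "f \<in> carrier (step_functions G)" for f
    using step_functionsD(3)[OF that] by (auto simp: step_truncate_def)
  ultimately have "homotopic_with (\<lambda>x. True) (step_topology G) (step_topology G) id (\<lambda>f x. \<one>)"
    by (subst homotopic_with) (force intro!: exI[of _ "\<lambda>(t, f). step_truncate G t f"])+
  then show ?thesis unfolding contractible_space_def by blast
qed

lemma group_hom_step_const: "group_hom G (step_functions G) (step_const G)"
proof -
  have "step_const G \<in> hom G (step_functions G)"
    by (rule homI) (auto simp: step_const_closed step_const_def)
  then show ?thesis
    using group_step_functions by (simp add: group_hom_def group_hom_axioms_def is_group)
qed

end

section \<open>Realizing normal maps by step functions\<close>

text \<open>The value at \<open>\<one>\<close> of a homomorphism into the automorphism group is an idempotent injective map,
  hence the identity.\<close>

lemma crossed_module_action: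
  assumes "crossed_module N G n l"
  shows "right_action_by_automorphisms N G l"
proof -
  interpret n: group_hom N G n using assms by (simp add: crossed_module_def)
  have l: "l \<in> hom G (right_AutoGroup N)" using assms by (simp add: crossed_module_def)
  have auto: "l g \<in> carrier (right_AutoGroup N)" if "g \<in> carrier G" for g
    using l that by (rule hom_in_carrier)
  have l_hom: "l g \<in> hom N N" and l_inj: "inj_on (l g) (carrier N)" if "g \<in> carrier G" for g
    using auto[OF that]
    by (auto simp: right_AutoGroup_def AutoGroup_def auto_def Bij_def bij_betw_def)
  have l_mult: "l (g \<otimes>\<^bsub>G\<^esub> h) a = l h (l g a)"
    if "a \<in> carrier N" "g \<in> carrier G" "h \<in> carrier G" for a g h
    using that auto by (simp add: hom_mult[OF l] right_AutoGroup_mult)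
  have "l \<one>\<^bsub>G\<^esub> a = a" if a: "a \<in> carrier N" for a
  proof -
    have "l \<one>\<^bsub>G\<^esub> (l \<one>\<^bsub>G\<^esub> a) = l \<one>\<^bsub>G\<^esub> a" using l_mult[OF a, of "\<one>\<^bsub>G\<^esub>" "\<one>\<^bsub>G\<^esub>"] by simp
    then show ?thesis
      using l_inj[of "\<one>\<^bsub>G\<^esub>"] a hom_in_carrier[OF l_hom a, of "\<one>\<^bsub>G\<^esub>"] by (simp add: inj_on_eq_iff)
  qed
  with l_hom l_mult show ?thesis
    by unfold_locales auto
qed

context right_action_by_automorphisms
begin

definition step_action :: "'b \<Rightarrow> (real \<Rightarrow> 'a) \<Rightarrow> real \<Rightarrow> 'a" where
  "step_action g f = (\<lambda>x. act g (f x))"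

lemma step_action_closed:
  "g \<in> carrier G \<Longrightarrow> f \<in> carrier (step_functions A) \<Longrightarrow> step_action g f \<in> carrier (step_functions A)"
  unfolding step_action_def by (rule step_functions_map[of _ A]) (auto simp: act_unit)

lemma contractible_semidirect_step:
  "contractible_semidirect (step_functions A) G step_action (step_topology A)"
proof -
  interpret E: topological_group "step_functions A" "step_topology A"
    by (rule A.topological_group_step_functions)
  show ?thesis
  proof
    show "step_action g \<in> hom (step_functions A) (step_functions A)" if g: "g \<in> carrier G" for g
    proof (rule homI)
      show "step_action g f \<in> carrier (step_functions A)" if "f \<in> carrier (step_functions A)" for f
        using g that by (rule step_action_closed)
    qed (use g in \<open>simp add: step_action_def act_distrib step_functionsD(2)\<close>)
    show "continuous_map (step_topology A) (step_topology A) (step_action g)" if "g \<in> carrier G" for g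
    proof (rule step_nonexpansive_continuous)
      fix f f' assume "f \<in> carrier (step_functions A)" "f' \<in> carrier (step_functions A)"
      then show "step_dist (step_action g f) (step_action g f') \<le> step_dist f f'"
        using that by (intro step_dist_le[of _ A _ _ A] step_action_closed) (simp_all add: step_action_def)
    qed (use that in \<open>rule step_action_closed\<close>)
    show "contractible_space (step_topology A)" by (rule A.contractible_step_functions)
  qed (auto simp: step_action_def act_one act_mult step_functionsD(2))
qed

end

text \<open>Pointwise application of the crossed module action to step functions satisfies both
  compatibilities with the constants: (NM2) says that \<open>n(a)\<close> acts on the values, hence on the
  step functions, as conjugation by \<open>a\<close>.\<close>

theorem normal_map_realization:
  fixes N :: "('a, 'q) monoid_scheme" and G :: "('b, 'r) monoid_scheme"
  assumes "normal_map N G n"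
  shows "\<exists>(Y :: ((real \<Rightarrow> 'a) \<times> 'b) monoid) S K \<alpha> \<beta>.
           topological_group Y S \<and> K \<lhd> Y \<and> closedin S K \<and>
           \<alpha> \<in> iso (pi0_sub Y S K) N \<and> \<beta> \<in> iso (pi0 Y S) G \<and>
           (\<forall>C \<in> carrier (pi0_sub Y S K). \<beta> (pi0_incl Y S C) = n (\<alpha> C)) \<and>
           homotopically_discrete (subtopology S K) \<and> homotopically_discrete S"
proof -
  obtain l where cm: "crossed_module N G n l" using assms by (auto simp: normal_map_def)
  interpret right_action_by_automorphisms N G l using cm by (rule crossed_module_action)
  interpret n: group_hom N G n using cm by (simp add: crossed_module_def)
  interpret E: group "step_functions N" by (rule A.group_step_functions)
  show ?thesis
  proof (rule crossed_module_realization)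
    show "contractible_semidirect (step_functions N) G step_action (step_topology N)"
      by (rule contractible_semidirect_step)
    show "crossed_module N G n l" by (rule cm)
    show "group_hom N (step_functions N) (step_const N)" by (rule A.group_hom_step_const)
    show "inj_on (step_const N) (carrier N)"
      by (rule inj_onI) (metis step_const_def atLeastLessThan_iff le_numeral_extra(3) zero_less_one)
    show "step_action g (step_const N a) = step_const N (l g a)"
      if "a \<in> carrier N" "g \<in> carrier G" for a g
      using that by (auto simp: step_action_def step_const_def act_unit)
    show "closedin (step_topology N) D" if "D \<subseteq> step_const N ` carrier N" for D
      using that by (rule closedin_step_constants) simp
    fix a f assume a: "a \<in> carrier N" and f: "f \<in> carrier (step_functions N)"
    have c: "step_const N a \<in> carrier (step_functions N)" using a by (simp add: step_const_closed)
    show "step_action (n a) f = conjugate (step_functions N) f (step_const N a)"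
    proof (rule step_functions_eqI)
      show "step_action (n a) f \<in> carrier (step_functions N)" using a f by (simp add: step_action_closed)
      show "conjugate (step_functions N) f (step_const N a) \<in> carrier (step_functions N)"
        using c f by (rule E.conjugate_closed[rotated])
      fix x :: real assume x: "x \<in> {0..<1}"
      have "l (n a) (f x) = conjugate N (f x) a"
        using cm a step_functionsD(2)[OF f] by (simp add: crossed_module_def)
      then show "step_action (n a) f x = conjugate (step_functions N) f (step_const N a) x"
        using x c by (simp add: step_action_def conjugate_def A.inv_step_functions step_const_def)
    qed
  qed
qed

theorem theorem1p1:
  fixes X :: "('x, 'p) monoid_scheme" and T :: "'x topology" and M :: "'x set"
    and N :: "('a, 'q) monoid_scheme" and G :: "('b, 'r) monoid_scheme" and n :: "'a \<Rightarrow> 'b"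
  shows
    "(topological_group X T \<and> M \<lhd> X \<longrightarrow>
        normal_map (pi0_sub X T M) (pi0 X T) (pi0_incl X T))
     \<and>
     (normal_map N G n \<longrightarrow>
        (\<exists>(Y :: ((real \<Rightarrow> 'a) \<times> 'b) monoid) S K \<alpha> \<beta>.
           topological_group Y S \<and> K \<lhd> Y \<and> closedin S K \<and>
           \<alpha> \<in> iso (pi0_sub Y S K) N \<and> \<beta> \<in> iso (pi0 Y S) G \<and>
           (\<forall>C \<in> carrier (pi0_sub Y S K). \<beta> (pi0_incl Y S C) = n (\<alpha> C))))
     \<and>
     (normal_map N G n \<longrightarrow>
        (\<exists>(Y :: ((real \<Rightarrow> 'a) \<times> 'b) monoid) S K \<alpha> \<beta>.
           topological_group Y S \<and> K \<lhd> Y \<and> closedin S K \<and>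
           \<alpha> \<in> iso (pi0_sub Y S K) N \<and> \<beta> \<in> iso (pi0 Y S) G \<and>
           (\<forall>C \<in> carrier (pi0_sub Y S K). \<beta> (pi0_incl Y S C) = n (\<alpha> C)) \<and>
           homotopically_discrete (subtopology S K) \<and> homotopically_discrete S))"
proof (intro conjI impI)
  assume "topological_group X T \<and> M \<lhd> X"
  then interpret topological_group_normal X T M
    by (simp add: topological_group_normal_def topological_group_normal_axioms_def)
  show "normal_map (pi0_sub X T M) (pi0 X T) (pi0_incl X T)"
    unfolding normal_map_def using crossed_module_pi0 by blast
next
  assume "normal_map N G n"
  from normal_map_realization[OF this]
  show "\<exists>(Y :: ((real \<Rightarrow> 'a) \<times> 'b) monoid) S K \<alpha> \<beta>.
           topological_group Y S \<and> K \<lhd> Y \<and> closedin S K \<and>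
           \<alpha> \<in> iso (pi0_sub Y S K) N \<and> \<beta> \<in> iso (pi0 Y S) G \<and>
           (\<forall>C \<in> carrier (pi0_sub Y S K). \<beta> (pi0_incl Y S C) = n (\<alpha> C))"
    by blast
next
  assume "normal_map N G n"
  then show "\<exists>(Y :: ((real \<Rightarrow> 'a) \<times> 'b) monoid) S K \<alpha> \<beta>.
           topological_group Y S \<and> K \<lhd> Y \<and> closedin S K \<and>
           \<alpha> \<in> iso (pi0_sub Y S K) N \<and> \<beta> \<in> iso (pi0 Y S) G \<and>
           (\<forall>C \<in> carrier (pi0_sub Y S K). \<beta> (pi0_incl Y S C) = n (\<alpha> C)) \<and>
           homotopically_discrete (subtopology S K) \<and> homotopically_discrete S"
    by (rule normal_map_realization)
qed

end
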